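(* Let $G,H$ be Lie groups with Lie algebras $\mathfrak g,\mathfrak h$, let $\Phi:G\to\mathrm{Aut}(H)$ be an action with differentiated action $\phi:\mathfrak g\to\mathrm{Der}(\mathfrak h)$, let $\mathcal B:H\to G$ be a relative Rota-Baxter operator on $G$ with respect to $(H;\Phi)$, and let $B=\mathcal B_{*e_H}:\mathfrak h\to\mathfrak g$. Then the Lie algebra $(\mathfrak h,[\cdot,\cdot]_\star)$ of the descendent Lie group $(H,e_H,\star)$ (on the underlying vector space $T_{e_H}H=\mathfrak h$) is the descendent Lie algebra $(\mathfrak h,[\cdot,\cdot]_B)$ of the relative Rota-Baxter operator $B$.
   Context: Lie groups are real and finite-dimensional. An action of $G$ on $H$ is a group homomorphism $\Phi:G\to\mathrm{Aut}(H)$ into the Lie group automorphisms of $H$ such that $(g,h)\mapsto\Phi(g)h$ is smooth. A relative Rota-Baxter operator on $G$ with respect to $(H;\Phi)$ is a smooth map $\mathcal B:H\to G$ with $\mathcal B(h_1)\cdot_G\mathcal B(h_2)=\mathcal B(h_1\cdot_H\Phi(\mathcal B(h_1))h_2)$ for all $h_1,h_2\in H$. Its descendent Lie group is the manifold $H$ with multiplication $h_1\star h_2=h_1\cdot_H\Phi(\mathcal B(h_1))h_2$ and unit $e_H$. Differentiated action: $\tilde\Phi(g)=\Phi(g)_{*e_H}\in\mathrm{Aut}(\mathfrak h)$, $\phi:=\tilde\Phi_{*e_G}:\mathfrak g\to\mathrm{Der}(\mathfrak h)$. The tangent map $B=\mathcal B_{*e_H}$ is a relative Rota-Baxter operator of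 weight $1$ on $\mathfrak g$ with respect to $(\mathfrak h;\phi)$, i.e. $[B(u),B(v)]_{\mathfrak g}=B(\phi(B(u))v-\phi(B(v))u+[u,v]_{\mathfrak h})$. Its descendent Lie algebra is $\mathfrak h$ with the bracket $[u,v]_B=\phi(B(u))v-\phi(B(v))u+[u,v]_{\mathfrak h}$. *)

theory Defs
  imports
    "HOL-Analysis.Analysis"
    "HOL-Algebra.Bij"
    "HOL-Library.Function_Algebras"
begin

section \<open>Smooth maps between open subsets of normed spaces\<close>

text \<open>
  All normed spaces below are finite-dimensional (see \<open>smooth_manifold\<close>), so that continuity of
  the directional derivatives is the same as continuity of the Frechet derivative.
\<close>

primrec times_cont_diff_on ::
  "nat \<Rightarrow> 'e::real_normed_vector set \<Rightarrow> ('e \<Rightarrow> 'f::real_normed_vector) \<Rightarrow> bool" where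
  "times_cont_diff_on 0 S f \<longleftrightarrow> continuous_on S f"
| "times_cont_diff_on (Suc n) S f \<longleftrightarrow>
     (\<forall>x\<in>S. f differentiable (at x)) \<and>
     (\<forall>v. times_cont_diff_on n S (\<lambda>x. frechet_derivative f (at x) v))"

definition smooth_on :: "'e::real_normed_vector set \<Rightarrow> ('e \<Rightarrow> 'f::real_normed_vector) \<Rightarrow> bool" where
  "smooth_on S f \<longleftrightarrow> (\<forall>n. times_cont_diff_on n S f)"


section \<open>Smooth manifolds\<close>

text \<open>
  A chart is a domain together with a coordinate map, whose values outside the domain are
  irrelevant.  The model space is a finite-dimensional \<open>real_normed_vector\<close> type rather than a
  \<open>euclidean_space\<close>, because the latter class excludes dimension \<open>0\<close>.
\<close>

type_synonym ('a, 'e) chart = "'a set \<times> ('a \<Rightarrow> 'e)"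

abbreviation chart_dom :: "('a, 'e) chart \<Rightarrow> 'a set" where
  "chart_dom c \<equiv> fst c"

abbreviation chart_map :: "('a, 'e) chart \<Rightarrow> 'a \<Rightarrow> 'e" where
  "chart_map c \<equiv> snd c"

definition chart_inv :: "('a, 'e) chart \<Rightarrow> 'e \<Rightarrow> 'a" where
  "chart_inv c = inv_into (chart_dom c) (chart_map c)"

record ('a, 'e) manifold =
  mtop :: "'a topology"
  atlas :: "('a, 'e) chart set"

abbreviation points :: "('a, 'e) manifold \<Rightarrow> 'a set" where
  "points M \<equiv> topspace (mtop M)"

definition smooth_manifold :: "('a, 'e::real_normed_vector) manifold \<Rightarrow> bool" where
  "smooth_manifold M \<longleftrightarrow>
     (\<exists>B::'e set. finite B \<and> span B = UNIV) \<and>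
     Hausdorff_space (mtop M) \<and> second_countable (mtop M) \<and>
     (\<Union>c\<in>atlas M. chart_dom c) = points M \<and>
     (\<forall>c\<in>atlas M. openin (mtop M) (chart_dom c) \<and> open (chart_map c ` chart_dom c) \<and>
        homeomorphic_map (subtopology (mtop M) (chart_dom c))
          (top_of_set (chart_map c ` chart_dom c)) (chart_map c)) \<and>
     (\<forall>c\<in>atlas M. \<forall>d\<in>atlas M.
        smooth_on (chart_map c ` (chart_dom c \<inter> chart_dom d)) (chart_map d \<circ> chart_inv c))"

definition smooth_map ::
  "('a, 'e::real_normed_vector) manifold \<Rightarrow> ('b, 'f::real_normed_vector) manifold \<Rightarrow> ('a \<Rightarrow> 'b) \<Rightarrow> bool"
where
  "smooth_map M N F \<longleftrightarrow> continuous_map (mtop M) (mtop N) F \<and>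
     (\<forall>c\<in>atlas M. \<forall>d\<in>atlas N.
        smooth_on (chart_map c ` {p \<in> chart_dom c. F p \<in> chart_dom d})
          (chart_map d \<circ> F \<circ> chart_inv c))"

definition prod_manifold ::
  "('a, 'e) manifold \<Rightarrow> ('b, 'f) manifold \<Rightarrow> ('a \<times> 'b, 'e \<times> 'f) manifold" where
  "prod_manifold M N =
     \<lparr>mtop = prod_topology (mtop M) (mtop N),
      atlas = {(chart_dom c \<times> chart_dom d, map_prod (chart_map c) (chart_map d)) | c d.
                 c \<in> atlas M \<and> d \<in> atlas N}\<rparr>"


section \<open>Tangent spaces and tangent maps\<close>

text \<open>
  A tangent vector at \<open>p\<close> is a family of coordinate vectors, one for each chart at \<open>p\<close>, obeying the
  usual transformation law; off the charts at \<open>p\<close> the family is \<open>0\<close>.  The vector space operations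
  of the tangent space are thus the pointwise ones, and for each chart at \<open>p\<close> evaluation at that
  chart is a linear isomorphism onto the model space.
\<close>

type_synonym ('a, 'e) tvec = "('a, 'e) chart \<Rightarrow> 'e"

definition charts_at :: "('a, 'e) manifold \<Rightarrow> 'a \<Rightarrow> ('a, 'e) chart set" where
  "charts_at M p = {c \<in> atlas M. p \<in> chart_dom c}"

definition tangent_space ::
  "('a, 'e::real_normed_vector) manifold \<Rightarrow> 'a \<Rightarrow> ('a, 'e) tvec set" where
  "tangent_space M p =
     {v. (\<forall>c. c \<notin> charts_at M p \<longrightarrow> v c = 0) \<and>
         (\<forall>c\<in>charts_at M p. \<forall>d\<in>charts_at M p.
            v d = frechet_derivative (chart_map d \<circ> chart_inv c) (at (chart_map c p)) (v c))}"

text \<open>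
  Derivative at \<open>p\<close> along the tangent vector \<open>v\<close> of a vector-valued function defined near \<open>p\<close>;
  by the transformation law and the chain rule the choice of the chart does not matter.
\<close>

definition deriv_along ::
  "('a, 'e::real_normed_vector) manifold \<Rightarrow> 'a \<Rightarrow> ('a, 'e) tvec \<Rightarrow> ('a \<Rightarrow> 'f::real_normed_vector) \<Rightarrow> 'f"
where
  "deriv_along M p v f =
     (let c = (SOME c. c \<in> charts_at M p)
      in frechet_derivative (f \<circ> chart_inv c) (at (chart_map c p)) (v c))"

definition tangent_map ::
  "('a, 'e::real_normed_vector) manifold \<Rightarrow> ('b, 'f::real_normed_vector) manifold \<Rightarrow>
   ('a \<Rightarrow> 'b) \<Rightarrow> 'a \<Rightarrow> ('a, 'e) tvec \<Rightarrow> ('b, 'f) tvec" where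
  "tangent_map M N F p v =
     (\<lambda>d. if d \<in> charts_at N (F p) then deriv_along M p v (chart_map d \<circ> F) else 0)"

text \<open>
  Lie bracket of vector fields, in local coordinates
  \<open>[X,Y]\<^sup>i = \<Sum>\<^sub>j X\<^sup>j \<partial>\<^sub>j Y\<^sup>i - Y\<^sup>j \<partial>\<^sub>j X\<^sup>i\<close>; it corresponds to the convention
  \<open>[X,Y] f = X (Y f) - Y (X f)\<close>.
\<close>

definition vf_bracket ::
  "('a, 'e::real_normed_vector) manifold \<Rightarrow>
   ('a \<Rightarrow> ('a, 'e) tvec) \<Rightarrow> ('a \<Rightarrow> ('a, 'e) tvec) \<Rightarrow> 'a \<Rightarrow> ('a, 'e) tvec" where
  "vf_bracket M X Y p =
     (\<lambda>c. if c \<in> charts_at M p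
          then deriv_along M p (X p) (\<lambda>q. Y q c) - deriv_along M p (Y p) (\<lambda>q. X q c)
          else 0)"


section \<open>Lie groups and their Lie algebras\<close>

record ('a, 'e) lie_group = "'a monoid" +
  mfd :: "('a, 'e) manifold"

definition is_lie_group :: "('a, 'e::real_normed_vector) lie_group \<Rightarrow> bool" where
  "is_lie_group G \<longleftrightarrow>
     group G \<and> smooth_manifold (mfd G) \<and> points (mfd G) = carrier G \<and>
     smooth_map (prod_manifold (mfd G) (mfd G)) (mfd G) (\<lambda>(x, y). x \<otimes>\<^bsub>G\<^esub> y) \<and>
     smooth_map (mfd G) (mfd G) (\<lambda>x. inv\<^bsub>G\<^esub> x)"

text \<open>
  A Lie algebra of tangent vectors: the underlying set of a vector space (with the pointwise
  operations) and a bracket, which is \<open>undefined\<close> off that set so that equality of such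
  records is equality of Lie algebras.
\<close>

record 'v lie_alg =
  vspace :: "'v set"
  bracket :: "'v \<Rightarrow> 'v \<Rightarrow> 'v"

definition left_invariant_field ::
  "('a, 'e::real_normed_vector) lie_group \<Rightarrow> ('a, 'e) tvec \<Rightarrow> 'a \<Rightarrow> ('a, 'e) tvec" where
  "left_invariant_field G v g = tangent_map (mfd G) (mfd G) (\<lambda>h. g \<otimes>\<^bsub>G\<^esub> h) \<one>\<^bsub>G\<^esub> v"

definition lie_algebra_of ::
  "('a, 'e::real_normed_vector) lie_group \<Rightarrow> ('a, 'e) tvec lie_alg" where
  "lie_algebra_of G =
     (let T = tangent_space (mfd G) \<one>\<^bsub>G\<^esub> in
      \<lparr>vspace = T,
       bracket = (\<lambda>u\<in>T. \<lambda>v\<in>T.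
         vf_bracket (mfd G) (left_invariant_field G u) (left_invariant_field G v) \<one>\<^bsub>G\<^esub>)\<rparr>)"


section \<open>Actions and relative Rota-Baxter operators\<close>

definition lie_Aut :: "('a, 'e::real_normed_vector) lie_group \<Rightarrow> ('a \<Rightarrow> 'a) monoid" where
  "lie_Aut H = AutoGroup H
     \<lparr>carrier := {f \<in> auto H. smooth_map (mfd H) (mfd H) f \<and>
                              smooth_map (mfd H) (mfd H) (inv_into (carrier H) f)}\<rparr>"

definition lie_group_action ::
  "('a, 'e::real_normed_vector) lie_group \<Rightarrow> ('b, 'f::real_normed_vector) lie_group \<Rightarrow>
   ('a \<Rightarrow> 'b \<Rightarrow> 'b) \<Rightarrow> bool" where
  "lie_group_action G H \<Phi> \<longleftrightarrow>
     \<Phi> \<in> hom G (lie_Aut H) \<and>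
     smooth_map (prod_manifold (mfd G) (mfd H)) (mfd H) (\<lambda>(g, h). \<Phi> g h)"

definition action_tilde ::
  "('b, 'f::real_normed_vector) lie_group \<Rightarrow> ('a \<Rightarrow> 'b \<Rightarrow> 'b) \<Rightarrow> 'a \<Rightarrow> ('b, 'f) tvec \<Rightarrow> ('b, 'f) tvec"
where
  "action_tilde H \<Phi> g = tangent_map (mfd H) (mfd H) (\<Phi> g) \<one>\<^bsub>H\<^esub>"

text \<open>
  The tangent map at the unit of \<open>action_tilde H \<Phi>\<close>, a map from \<open>G\<close> to the linear endomorphisms
  of \<open>\<hh>\<close>; these form a vector space, and the derivative is taken after applying the
  (linear) evaluations at \<open>v \<in> \<hh>\<close> and at a chart \<open>d\<close>.
\<close>

definition differentiated_action ::
  "('a, 'e::real_normed_vector) lie_group \<Rightarrow> ('b, 'f::real_normed_vector) lie_group \<Rightarrow>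
   ('a \<Rightarrow> 'b \<Rightarrow> 'b) \<Rightarrow> ('a, 'e) tvec \<Rightarrow> ('b, 'f) tvec \<Rightarrow> ('b, 'f) tvec" where
  "differentiated_action G H \<Phi> x v =
     (\<lambda>d. if d \<in> charts_at (mfd H) \<one>\<^bsub>H\<^esub>
          then deriv_along (mfd G) \<one>\<^bsub>G\<^esub> x (\<lambda>g. action_tilde H \<Phi> g v d)
          else 0)"

definition relative_rota_baxter ::
  "('a, 'e::real_normed_vector) lie_group \<Rightarrow> ('b, 'f::real_normed_vector) lie_group \<Rightarrow>
   ('a \<Rightarrow> 'b \<Rightarrow> 'b) \<Rightarrow> ('b \<Rightarrow> 'a) \<Rightarrow> bool" where
  "relative_rota_baxter G H \<Phi> \<B> \<longleftrightarrow>
     smooth_map (mfd H) (mfd G) \<B> \<and>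
     (\<forall>h1\<in>carrier H. \<forall>h2\<in>carrier H.
        \<B> h1 \<otimes>\<^bsub>G\<^esub> \<B> h2 = \<B> (h1 \<otimes>\<^bsub>H\<^esub> \<Phi> (\<B> h1) h2))"

definition descendent_lie_group ::
  "('b, 'f) lie_group \<Rightarrow> ('a \<Rightarrow> 'b \<Rightarrow> 'b) \<Rightarrow> ('b \<Rightarrow> 'a) \<Rightarrow> ('b, 'f) lie_group" where
  "descendent_lie_group H \<Phi> \<B> = H\<lparr>mult := \<lambda>h1 h2. h1 \<otimes>\<^bsub>H\<^esub> \<Phi> (\<B> h1) h2\<rparr>"

definition descendent_lie_algebra ::
  "('v::{plus,minus}) lie_alg \<Rightarrow> ('w \<Rightarrow> 'v \<Rightarrow> 'v) \<Rightarrow> ('v \<Rightarrow> 'w) \<Rightarrow> 'v lie_alg" where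
  "descendent_lie_algebra \<hh> \<phi> B =
     \<hh>\<lparr>bracket := \<lambda>u\<in>vspace \<hh>. \<lambda>v\<in>vspace \<hh>. \<phi> (B u) v - \<phi> (B v) u + bracket \<hh> u v\<rparr>"

end

theory Submission
  imports Defs
begin

text \<open>
  The left translation by \<open>q\<close> of the descendent group is \<open>h \<mapsto> q \<cdot> \<Phi> (\<B> q) h\<close>, that is, the
  automorphism \<open>\<Phi> (\<B> q)\<close> followed by the left translation of \<open>H\<close>.  As automorphisms fix the unit,
  the chain rule gives, for a tangent vector \<open>v\<close> at the unit, the left-invariant field of the
  descendent group as \<open>L\<^sup>\<star>\<^sub>v(q) = L\<^sub>t(q)\<close> with \<open>t = D(\<Phi> (\<B> q)) v\<close>, the differential being taken at the
  unit.  Thus \<open>q\<close> enters at two places: as the base point of an ordinary left-invariant field, and through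
  the vector that generates it.  Differentiate along \<open>u\<close> at the unit.  Since \<open>\<B>\<close> sends the unit to
  the unit and \<open>\<Phi>\<close> of the unit is the identity, the first place contributes the derivative of
  \<open>L\<^sub>v\<close> along \<open>u\<close>, and the second one contributes \<open>\<phi> (B u) v\<close>.  Exchanging \<open>u\<close> and \<open>v\<close> and
  subtracting gives \<open>[u, v]\<close> plus \<open>\<phi> (B u) v - \<phi> (B v) u\<close>.

  All this is carried out in one chart of \<open>H\<close> and one chart of \<open>G\<close> around the units.  There
  \<open>L\<^sub>t(q)\<close> becomes \<open>left_mult_deriv d x t\<close>, linear in \<open>t\<close>, and \<open>\<Phi>\<close> differentiated in its second
  argument becomes \<open>action_deriv z\<close>.  The product rule needed for a linear family applied to a
  moving vector is \<open>has_derivative_linear_family\<close>, and \<open>deriv_descendent_field\<close> is the resulting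
  formula for the derivative of \<open>L\<^sup>\<star>\<^sub>v\<close>.  The product rule uses finite dimension: only the
  directional derivatives of the linear family are known, and they control the family uniformly
  because the coordinates with respect to a basis are continuous.
\<close>

section \<open>Finite-dimensional normed spaces\<close>

text \<open>
  The coordinate \<open>k\<close> of \<open>k *\<^sub>R b + y\<close> is bounded because \<open>b\<close> has positive distance from the closed
  subspace.  This gives both the completeness of spans of finite sets and the continuity of
  coordinates.
\<close>

lemma closed_subspace_coordinate_bound:
  fixes b :: "'v::real_normed_vector"
  assumes "subspace S" "closed S" "b \<notin> S"
  obtains \<delta> where "\<delta> > 0" "\<And>k y. y \<in> S \<Longrightarrow> \<bar>k\<bar> * \<delta> \<le> norm (k *\<^sub>R b + y)"
proof
  have ne: "S \<noteq> {}" using subspace_0[OF assms(1)] by blast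
  show "infdist b S > 0"
    using infdist_pos_not_in_closed[OF assms(2) ne assms(3)] .
  fix k :: real and y assume y: "y \<in> S"
  show "\<bar>k\<bar> * infdist b S \<le> norm (k *\<^sub>R b + y)"
  proof (cases "k = 0")
    case False
    have "- (1/k) *\<^sub>R y \<in> S" using y assms(1) by (simp add: subspace_scale subspace_neg)
    then have "infdist b S \<le> dist b (- (1/k) *\<^sub>R y)" by (rule infdist_le)
    then have "\<bar>k\<bar> * infdist b S \<le> \<bar>k\<bar> * norm (b + (1/k) *\<^sub>R y)"
      by (intro mult_left_mono) (simp_all add: dist_norm)
    also have "\<dots> = norm (k *\<^sub>R (b + (1/k) *\<^sub>R y))" by simp
    also have "k *\<^sub>R (b + (1/k) *\<^sub>R y) = k *\<^sub>R b + y" using False by (simp add: scaleR_right_distrib)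
    finally show ?thesis .
  qed simp
qed

lemma Cauchy_diff_seq:
  fixes X Y :: "nat \<Rightarrow> 'v::real_normed_vector"
  assumes "Cauchy X" "Cauchy Y"
  shows "Cauchy (\<lambda>n. X n - Y n)"
proof (rule metric_CauchyI)
  fix e :: real assume "e > 0"
  then obtain N1 N2 where N: "\<And>m n. m \<ge> N1 \<Longrightarrow> n \<ge> N1 \<Longrightarrow> dist (X m) (X n) < e / 2"
      "\<And>m n. m \<ge> N2 \<Longrightarrow> n \<ge> N2 \<Longrightarrow> dist (Y m) (Y n) < e / 2"
    using metric_CauchyD[OF assms(1), of "e / 2"] metric_CauchyD[OF assms(2), of "e / 2"]
    by (metis half_gt_zero)
  have "dist (X m - Y m) (X n - Y n) < e" if "m \<ge> max N1 N2" "n \<ge> max N1 N2" for m n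
    using N(1)[of m n] N(2)[of m n] that norm_diff_triangle_ineq[of "X m" "- Y m" "X n" "- Y n"]
    by (simp add: dist_norm norm_minus_commute)
  then show "\<exists>M. \<forall>m\<ge>M. \<forall>n\<ge>M. dist (X m - Y m) (X n - Y n) < e" by blast
qed

text \<open>
  Adjoining one vector to a complete span: the coefficients of the new vector along a Cauchy
  sequence are themselves Cauchy, and so are the remainders in the old span.
\<close>

lemma complete_span_finite:
  fixes B :: "'v::real_normed_vector set"
  assumes "finite B"
  shows "complete (span B)"
  using assms
proof (induction B)
  case empty
  show ?case by (simp add: compact_imp_complete)
next
  case (insert b B)
  show ?case
  proof (cases "b \<in> span B")
    case True
    then show ?thesis using insert.IH by (simp add: span_redundant)
  next
    case False
    obtain \<delta> where \<delta>: "\<delta> > 0"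
      and bound: "\<And>k y. y \<in> span B \<Longrightarrow> \<bar>k\<bar> * \<delta> \<le> norm (k *\<^sub>R b + y)"
      using closed_subspace_coordinate_bound[OF subspace_span complete_imp_closed[OF insert.IH] False]
      by metis
    show ?thesis
    proof (rule completeI)
      fix X assume X: "\<forall>n. X n \<in> span (insert b B)" "Cauchy X"
      have "\<forall>n. \<exists>k. X n - k *\<^sub>R b \<in> span B" using X(1) by (simp add: span_insert)
      then obtain k where k: "\<And>n. X n - k n *\<^sub>R b \<in> span B" by metis
      have k_le: "\<bar>k m - k n\<bar> * \<delta> \<le> norm (X m - X n)" for m n
        using bound[OF span_diff[OF k[of m] k[of n]], of "k m - k n"]
        by (simp add: algebra_simps)
      have "Cauchy k"
      proof (rule metric_CauchyI)
        fix e :: real assume "e > 0"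
        then obtain N where N: "\<And>m n. m \<ge> N \<Longrightarrow> n \<ge> N \<Longrightarrow> dist (X m) (X n) < e * \<delta>"
          using metric_CauchyD[OF X(2), of "e * \<delta>"] \<delta> by auto
        have "dist (k m) (k n) < e" if "m \<ge> N" "n \<ge> N" for m n
        proof -
          have "\<bar>k m - k n\<bar> * \<delta> < e * \<delta>"
            using k_le[of m n] N[OF that] by (simp add: dist_norm)
          then show ?thesis using \<delta> by (simp add: dist_real_def)
        qed
        then show "\<exists>M. \<forall>m\<ge>M. \<forall>n\<ge>M. dist (k m) (k n) < e" by blast
      qed
      then obtain l where l: "k \<longlonglongrightarrow> l" using Cauchy_convergent convergent_def by blast
      have lb: "(\<lambda>n. k n *\<^sub>R b) \<longlonglongrightarrow> l *\<^sub>R b" by (intro tendsto_intros l)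
      have "Cauchy (\<lambda>n. X n - k n *\<^sub>R b)"
        using X(2) LIMSEQ_imp_Cauchy[OF lb] by (rule Cauchy_diff_seq)
      with insert.IH k obtain y where y: "y \<in> span B" "(\<lambda>n. X n - k n *\<^sub>R b) \<longlonglongrightarrow> y"
        using completeE[of "span B" "\<lambda>n. X n - k n *\<^sub>R b"] by metis
      have "X \<longlonglongrightarrow> y + l *\<^sub>R b"
        using tendsto_add[OF y(2) lb] by simp
      moreover have "y + l *\<^sub>R b \<in> span (insert b B)"
        using y(1) by (auto simp: span_insert intro!: exI[of _ l])
      ultimately show "\<exists>l\<in>span (insert b B). X \<longlonglongrightarrow> l" by (rule rev_bexI[rotated])
    qed
  qed
qed

lemma bounded_linear_representation:
  fixes B :: "'v::real_normed_vector set"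
  assumes "finite B" "independent B" "span B = UNIV" "b \<in> B"
  shows "bounded_linear (\<lambda>x. representation B x b)"
proof -
  have b: "b \<notin> span (B - {b})" using assms(2,4) by (simp add: dependent_def)
  have "complete (span (B - {b}))" using assms(1) by (simp add: complete_span_finite)
  then obtain \<delta> where \<delta>: "\<delta> > 0"
      and bound: "\<And>k y. y \<in> span (B - {b}) \<Longrightarrow> \<bar>k\<bar> * \<delta> \<le> norm (k *\<^sub>R b + y)"
    using closed_subspace_coordinate_bound[OF subspace_span complete_imp_closed b] by metis
  show ?thesis
  proof (rule bounded_linear_intro[where K = "1 / \<delta>"])
    show "representation B (x + y) b = representation B x b + representation B y b" for x y
      using assms(2,3) by (simp add: representation_add)
    show "representation B (r *\<^sub>R x) b = r *\<^sub>R representation B x b" for r x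
      using assms(2,3) by (simp add: representation_scale)
    fix x
    have "x = (\<Sum>c\<in>B. representation B x c *\<^sub>R c)"
      using sum_representation_eq[OF assms(2) _ assms(1) order_refl, of x] assms(3) by simp
    also have "\<dots> = representation B x b *\<^sub>R b + (\<Sum>c\<in>B-{b}. representation B x c *\<^sub>R c)"
      using assms(1,4) by (simp add: sum.remove)
    finally have x: "x = representation B x b *\<^sub>R b + (\<Sum>c\<in>B-{b}. representation B x c *\<^sub>R c)" .
    have "(\<Sum>c\<in>B-{b}. representation B x c *\<^sub>R c) \<in> span (B - {b})"
      by (intro span_sum span_scale span_base)
    from bound[OF this, of "representation B x b"] x
    have "\<bar>representation B x b\<bar> * \<delta> \<le> norm x" by simp
    then show "norm (representation B x b) \<le> norm x * (1 / \<delta>)"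
      using \<delta> by (simp add: field_simps)
  qed
qed

section \<open>Differential calculus\<close>

text \<open>
  Product rule for a family \<open>M x\<close> of linear maps applied to a moving vector \<open>\<sigma> x\<close>, under
  differentiability of \<open>M\<close> on each fixed vector alone.  Expanding \<open>\<sigma> x\<close> in a basis turns the
  expression into a finite sum of scalar functions times the functions \<open>\<lambda>x. M x b\<close>.
\<close>

lemma has_derivative_linear_family:
  fixes M :: "'x::real_normed_vector \<Rightarrow> 'v::real_normed_vector \<Rightarrow> 'w::real_normed_vector"
  assumes fin: "finite C" "span C = (UNIV :: 'v set)"
    and lin: "\<forall>\<^sub>F x in nhds x0. linear (M x)"
    and diff: "\<And>t. (\<lambda>x. M x t) differentiable (at x0)"
    and \<sigma>: "(\<sigma> has_derivative \<sigma>') (at x0)"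
  shows "((\<lambda>x. M x (\<sigma> x)) has_derivative
    (\<lambda>u. frechet_derivative (\<lambda>x. M x (\<sigma> x0)) (at x0) u + M x0 (\<sigma>' u))) (at x0)"
proof -
  obtain B :: "'v set" where B: "B \<subseteq> C" "independent B" "C \<subseteq> span B"
    using maximal_independent_subset[of C] by metis
  have finB: "finite B" using B(1) fin(1) finite_subset by blast
  have spanB: "span B = UNIV"
    using span_mono[OF B(3)] fin(2) by (simp add: span_span top.extremum_unique)
  let ?r = "\<lambda>b t. representation B t b"
  have expand: "L t = (\<Sum>b\<in>B. ?r b t *\<^sub>R L b)" if "linear L" for L :: "'v \<Rightarrow> 'w" and t
  proof -
    have "L (\<Sum>b\<in>B. ?r b t *\<^sub>R b) = (\<Sum>b\<in>B. ?r b t *\<^sub>R L b)"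
      using that by (simp add: linear_sum linear_cmul)
    then show ?thesis
      using sum_representation_eq[OF B(2) _ finB order_refl, of t] spanB by simp
  qed
  have lin0: "linear (M x0)" using eventually_nhds_x_imp_x[OF lin] .
  have D: "((\<lambda>x. M x t) has_derivative frechet_derivative (\<lambda>x. M x t) (at x0)) (at x0)" for t
    using diff frechet_derivative_works by blast
  have r: "((\<lambda>x. ?r b (\<sigma> x)) has_derivative (\<lambda>u. ?r b (\<sigma>' u))) (at x0)" if "b \<in> B" for b
    by (rule bounded_linear.has_derivative[OF bounded_linear_representation[OF finB B(2) spanB that] \<sigma>])
  let ?S = "\<lambda>u. \<Sum>b\<in>B. ?r b (\<sigma> x0) *\<^sub>R frechet_derivative (\<lambda>x. M x b) (at x0) u"
  have 1: "((\<lambda>x. \<Sum>b\<in>B. ?r b (\<sigma> x) *\<^sub>R M x b) has_derivative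
      (\<lambda>u. \<Sum>b\<in>B. ?r b (\<sigma> x0) *\<^sub>R frechet_derivative (\<lambda>x. M x b) (at x0) u
             + ?r b (\<sigma>' u) *\<^sub>R M x0 b)) (at x0)"
    by (intro has_derivative_sum has_derivative_scaleR r D)
  have 2: "((\<lambda>x. \<Sum>b\<in>B. ?r b (\<sigma> x0) *\<^sub>R M x b) has_derivative ?S) (at x0)"
    by (intro has_derivative_sum has_derivative_scaleR_right D)
  have ev: "\<forall>\<^sub>F x in at x0. (\<Sum>b\<in>B. ?r b (f x) *\<^sub>R M x b) = M x (f x)" for f
    using eventually_nhds_x_imp_x[OF lin] lin
    by (auto simp: eventually_at_filter expand[symmetric] elim!: eventually_mono)
  have "((\<lambda>x. M x (\<sigma> x0)) has_derivative ?S) (at x0)"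
    using has_derivative_transform_eventually[OF 2 ev] expand[OF lin0, symmetric] by simp
  then have "frechet_derivative (\<lambda>x. M x (\<sigma> x0)) (at x0) = ?S"
    by (metis frechet_derivative_at)
  moreover have "((\<lambda>x. M x (\<sigma> x)) has_derivative
      (\<lambda>u. \<Sum>b\<in>B. ?r b (\<sigma> x0) *\<^sub>R frechet_derivative (\<lambda>x. M x b) (at x0) u
             + ?r b (\<sigma>' u) *\<^sub>R M x0 b)) (at x0)"
    using has_derivative_transform_eventually[OF 1 ev] expand[OF lin0, symmetric] by simp
  ultimately show ?thesis
    by (simp add: sum.distrib expand[OF lin0, symmetric])
qed

lemma has_derivative_partial_chain:
  assumes "f differentiable (at (x, g y))" "(g has_derivative g') (at y)"
  shows "((\<lambda>y. f (x, g y)) has_derivative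
           (\<lambda>v. frechet_derivative f (at (x, g y)) (0, g' v))) (at y)"
proof -
  have "((\<lambda>y. (x, g y)) has_derivative (\<lambda>v. (0, g' v))) (at y)"
    using assms(2) by (intro derivative_intros)
  moreover have "(f has_derivative frechet_derivative f (at (x, g y))) (at (x, g y))"
    using assms(1) frechet_derivative_works by blast
  ultimately show ?thesis
    using has_derivative_compose by blast
qed

lemma differentiable_slice:
  assumes "F differentiable (at (x, y))"
  shows "(\<lambda>x. F (x, y)) differentiable (at x)"
  by (rule differentiable_compose[of F "\<lambda>x. (x, y)", OF assms])
     (auto simp: differentiable_def intro!: derivative_intros exI)

lemma has_derivative_cong_nhds:
  assumes "\<forall>\<^sub>F x in nhds x0. f x = g x"
  shows "(f has_derivative f') (at x0) \<longleftrightarrow> (g has_derivative f') (at x0)"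
proof -
  have ev: "\<forall>\<^sub>F x in at x0. f x = g x" "\<forall>\<^sub>F x in at x0. g x = f x"
    using assms by (auto simp: eventually_at_filter elim: eventually_mono)
  show ?thesis
    using has_derivative_transform_eventually[OF _ ev(1)] has_derivative_transform_eventually[OF _ ev(2)]
      eventually_nhds_x_imp_x[OF assms] by auto
qed

lemma frechet_derivative_cong:
  assumes "\<forall>\<^sub>F x in nhds x0. f x = g x"
  shows "frechet_derivative f (at x0) = frechet_derivative g (at x0)"
proof -
  have "(f has_derivative f') (at x0) \<longleftrightarrow> (g has_derivative f') (at x0)" for f'
    using has_derivative_cong_nhds[OF assms] .
  then show ?thesis unfolding frechet_derivative_def by simp
qed

lemma differentiable_cong_nhds:
  assumes "\<forall>\<^sub>F x in nhds x0. f x = g x"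
  shows "f differentiable (at x0) \<longleftrightarrow> g differentiable (at x0)"
proof -
  have "(f has_derivative f') (at x0) \<longleftrightarrow> (g has_derivative f') (at x0)" for f'
    using has_derivative_cong_nhds[OF assms] .
  then show ?thesis unfolding differentiable_def by simp
qed

lemma smooth_on_twice_differentiable:
  assumes "smooth_on S f" "x \<in> S"
  shows "f differentiable (at x)" "(\<lambda>x. frechet_derivative f (at x) v) differentiable (at x)"
proof -
  have "times_cont_diff_on (Suc (Suc 0)) S f" using assms(1) unfolding smooth_on_def by blast
  then show "f differentiable (at x)" "(\<lambda>x. frechet_derivative f (at x) v) differentiable (at x)"
    using assms(2) by simp_all
qed

lemma twice_differentiable_cong:
  assumes "open S" "x \<in> S" "\<And>y. y \<in> S \<Longrightarrow> f y = g y"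
    and f: "smooth_on S f"
  shows "g differentiable (at x)" "(\<lambda>x. frechet_derivative g (at x) v) differentiable (at x)"
proof -
  have eq: "\<forall>\<^sub>F y in nhds x. f y = g y" if "x \<in> S" for x
    using assms(1,3) that eventually_nhds by blast
  then have "frechet_derivative f (at y) v = frechet_derivative g (at y) v" if "y \<in> S" for y
    using frechet_derivative_cong that by metis
  then have "\<forall>\<^sub>F y in nhds x. frechet_derivative f (at y) v = frechet_derivative g (at y) v"
    using assms(1,2) eventually_nhds by blast
  from differentiable_cong_nhds[OF this] differentiable_cong_nhds[OF eq[OF assms(2)]]
  show "g differentiable (at x)" "(\<lambda>x. frechet_derivative g (at x) v) differentiable (at x)"
    using smooth_on_twice_differentiable[OF f assms(2)] by simp_all
qed

section \<open>Smooth maps in charts\<close>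

lemma chart_inv_chart_map:
  assumes "smooth_manifold M" "c \<in> atlas M" "p \<in> chart_dom c"
  shows "chart_inv c (chart_map c p) = p"
proof -
  have "inj_on (chart_map c) (topspace (subtopology (mtop M) (chart_dom c)))"
    using assms(1,2) unfolding smooth_manifold_def homeomorphic_eq_everything_map by blast
  moreover have "chart_dom c \<subseteq> topspace (mtop M)"
    using assms(1,2) openin_subset unfolding smooth_manifold_def by blast
  ultimately have "inj_on (chart_map c) (chart_dom c)" by (simp add: Int_absorb1)
  then show ?thesis using assms(3) by (simp add: chart_inv_def inv_into_f_f)
qed

lemma chart_properties:
  assumes "smooth_manifold M" "c \<in> atlas M"
  shows "openin (mtop M) (chart_dom c)" "open (chart_map c ` chart_dom c)"
    and "chart_dom c \<subseteq> points M"
    and "continuous_map (top_of_set (chart_map c ` chart_dom c)) (mtop M) (chart_inv c)"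
proof -
  show "openin (mtop M) (chart_dom c)" "open (chart_map c ` chart_dom c)"
    using assms unfolding smooth_manifold_def by blast+
  then show sub: "chart_dom c \<subseteq> points M" using openin_subset by blast
  have "homeomorphic_map (subtopology (mtop M) (chart_dom c))
          (top_of_set (chart_map c ` chart_dom c)) (chart_map c)"
    using assms unfolding smooth_manifold_def by blast
  then obtain g where g: "homeomorphic_maps (subtopology (mtop M) (chart_dom c))
          (top_of_set (chart_map c ` chart_dom c)) (chart_map c) g"
    using homeomorphic_map_maps by blast
  have "continuous_map (top_of_set (chart_map c ` chart_dom c)) (mtop M) g"
    using g continuous_map_in_subtopology unfolding homeomorphic_maps_def by blast
  moreover have "g x = chart_inv c x" if "x \<in> chart_map c ` chart_dom c" for x
    using g that sub chart_inv_chart_map[OF assms] unfolding homeomorphic_maps_def by auto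
  ultimately show "continuous_map (top_of_set (chart_map c ` chart_dom c)) (mtop M) (chart_inv c)"
    by (auto intro: continuous_map_eq)
qed

lemma open_preimage_parametrization:
  assumes "open V" "continuous_map (top_of_set V) X \<sigma>" "continuous_map X Y F" "openin Y D"
  shows "open {x \<in> V. F (\<sigma> x) \<in> D}"
proof -
  have "openin (top_of_set V) {x \<in> topspace (top_of_set V). (F \<circ> \<sigma>) x \<in> D}"
    using continuous_map_compose[OF assms(2,3)] assms(4) by (rule openin_continuous_map_preimage)
  then show ?thesis using assms(1) openin_open_trans by auto
qed

lemma smooth_map_in_chart:
  assumes M: "smooth_manifold M" and N: "smooth_manifold N" and F: "smooth_map M N F"
    and c: "c \<in> atlas M" and d: "d \<in> atlas N"
    and p: "p \<in> chart_dom c" "F p \<in> chart_dom d"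
  shows "\<forall>\<^sub>F x in nhds (chart_map c p). x \<in> chart_map c ` chart_dom c \<and> F (chart_inv c x) \<in> chart_dom d"
    and "(chart_map d \<circ> F \<circ> chart_inv c) differentiable (at (chart_map c p))"
proof -
  have "open {x \<in> chart_map c ` chart_dom c. F (chart_inv c x) \<in> chart_dom d}"
    using open_preimage_parametrization chart_properties[OF M c] chart_properties[OF N d] F
    unfolding smooth_map_def by blast
  moreover have "chart_map c p \<in> {x \<in> chart_map c ` chart_dom c. F (chart_inv c x) \<in> chart_dom d}"
    using p chart_inv_chart_map[OF M c] by auto
  ultimately show "\<forall>\<^sub>F x in nhds (chart_map c p). x \<in> chart_map c ` chart_dom c \<and> F (chart_inv c x) \<in> chart_dom d"
    unfolding eventually_nhds by blast
  have "smooth_on (chart_map c ` {p \<in> chart_dom c. F p \<in> chart_dom d}) (chart_map d \<circ> F \<circ> chart_inv c)"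
    using F c d unfolding smooth_map_def by blast
  then show "(chart_map d \<circ> F \<circ> chart_inv c) differentiable (at (chart_map c p))"
    using p by (blast intro: smooth_on_twice_differentiable)
qed

text \<open>
  The inverse of a product chart agrees with the pair of inverses only over the product of the chart
  images, so the derivatives of \<open>f\<close> are compared with those of the chart representation through the
  openness of \<open>S\<close>.
\<close>

lemma smooth_map_in_product_chart:
  fixes F :: "'p \<Rightarrow> 'q \<Rightarrow> 'r"
    and a :: "('p, 'x::real_normed_vector) chart" and c :: "('q, 'y::real_normed_vector) chart"
    and d :: "('r, 'z::real_normed_vector) chart"
  assumes M: "smooth_manifold M" and N: "smooth_manifold N" and P: "smooth_manifold P"
    and F: "smooth_map (prod_manifold M N) P (\<lambda>(p, q). F p q)"
    and a: "a \<in> atlas M" and c: "c \<in> atlas N" and d: "d \<in> atlas P"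
  defines "S \<equiv> {(x, y). x \<in> chart_map a ` chart_dom a \<and> y \<in> chart_map c ` chart_dom c \<and>
                   F (chart_inv a x) (chart_inv c y) \<in> chart_dom d}"
    and "f \<equiv> \<lambda>(x, y). chart_map d (F (chart_inv a x) (chart_inv c y))"
  shows "open S" "\<And>z. z \<in> S \<Longrightarrow> f differentiable (at z)"
    and "\<And>z w. z \<in> S \<Longrightarrow> (\<lambda>z. frechet_derivative f (at z) w) differentiable (at z)"
proof -
  let ?V = "chart_map a ` chart_dom a" and ?W = "chart_map c ` chart_dom c"
  let ?e = "(chart_dom a \<times> chart_dom c, map_prod (chart_map a) (chart_map c))"
  let ?F = "\<lambda>(p, q). F p q"
  have e: "?e \<in> atlas (prod_manifold M N)"
    using a c unfolding prod_manifold_def by (simp del: split_paired_Ex) blast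
  have inv_a: "chart_inv a (chart_map a p) = p" if "p \<in> chart_dom a" for p
    using chart_inv_chart_map[OF M a that] .
  have inv_c: "chart_inv c (chart_map c p) = p" if "p \<in> chart_dom c" for p
    using chart_inv_chart_map[OF N c that] .
  have inj: "inj_on (map_prod (chart_map a) (chart_map c)) (chart_dom a \<times> chart_dom c)"
    using inv_a inv_c by (intro map_prod_inj_on) (metis inj_onI)+
  have inv_e: "chart_inv ?e (x, y) = (chart_inv a x, chart_inv c y)" if xy: "x \<in> ?V" "y \<in> ?W" for x y
  proof -
    obtain p q where p: "p \<in> chart_dom a" "x = chart_map a p" and q: "q \<in> chart_dom c" "y = chart_map c q"
      using xy by blast
    have "inv_into (chart_dom a \<times> chart_dom c) (map_prod (chart_map a) (chart_map c))
            (map_prod (chart_map a) (chart_map c) (p, q)) = (p, q)"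
      using inj p q by (intro inv_into_f_f) auto
    then show ?thesis using p q inv_a inv_c by (simp add: chart_inv_def[of ?e])
  qed
  have S_eq: "S = chart_map ?e ` {p \<in> chart_dom ?e. ?F p \<in> chart_dom d}" (is "_ = ?S")
  proof (intro Set.set_eqI iffI)
    fix z assume "z \<in> S"
    then obtain p q where "p \<in> chart_dom a" "q \<in> chart_dom c" "z = (chart_map a p, chart_map c q)"
      and "F p q \<in> chart_dom d"
      using inv_a inv_c unfolding S_def by auto
    then show "z \<in> ?S" by (auto intro!: image_eqI[of _ _ "(p, q)"])
  next
    fix z assume "z \<in> ?S"
    then show "z \<in> S" using inv_a inv_c unfolding S_def by auto
  qed
  have "continuous_map (top_of_set (?V \<times> ?W)) (prod_topology (mtop M) (mtop N))
          (\<lambda>z. (chart_inv a (fst z), chart_inv c (snd z)))"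
  proof -
    have "continuous_map (prod_topology (top_of_set ?V) (top_of_set ?W)) (prod_topology (mtop M) (mtop N))
          (\<lambda>(x, y). (chart_inv a x, chart_inv c y))"
      using chart_properties(4)[OF M a] chart_properties(4)[OF N c]
      by (blast intro: iffD2[OF continuous_map_prod_top])
    moreover have "prod_topology (top_of_set ?V) (top_of_set ?W) = top_of_set (?V \<times> ?W)"
      by (simp add: prod_topology_subtopology_eu)
    ultimately show ?thesis by (simp add: case_prod_unfold)
  qed
  moreover have "open (?V \<times> ?W)"
    using chart_properties(2)[OF M a] chart_properties(2)[OF N c] by (rule open_Times)
  moreover have "continuous_map (prod_topology (mtop M) (mtop N)) (mtop P) ?F"
    using F unfolding smooth_map_def prod_manifold_def by simp
  ultimately have "open {z \<in> ?V \<times> ?W. ?F (chart_inv a (fst z), chart_inv c (snd z)) \<in> chart_dom d}"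
    using open_preimage_parametrization chart_properties(1)[OF P d] by blast
  moreover have "{z \<in> ?V \<times> ?W. ?F (chart_inv a (fst z), chart_inv c (snd z)) \<in> chart_dom d} = S"
    unfolding S_def by auto
  ultimately show S: "open S" by simp
  have smooth: "smooth_on S (chart_map d \<circ> ?F \<circ> chart_inv ?e)"
    using F e d unfolding smooth_map_def S_eq by blast
  have eq: "(chart_map d \<circ> ?F \<circ> chart_inv ?e) z = f z" if "z \<in> S" for z
    using that inv_e unfolding S_def f_def by auto
  show "f differentiable (at z)" "(\<lambda>z. frechet_derivative f (at z) w) differentiable (at z)"
    if "z \<in> S" for z w
    using twice_differentiable_cong[OF S that eq smooth] by auto
qed

section \<open>Actions and the operator at the units\<close>

locale rota_baxter_operator =
  fixes G :: "('a, 'e::real_normed_vector) lie_group"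
    and H :: "('b, 'f::real_normed_vector) lie_group"
    and \<Phi> :: "'a \<Rightarrow> 'b \<Rightarrow> 'b"
    and \<B> :: "'b \<Rightarrow> 'a"
  assumes G: "is_lie_group G"
    and H: "is_lie_group H"
    and action: "lie_group_action G H \<Phi>"
    and rota_baxter: "relative_rota_baxter G H \<Phi> \<B>"
begin

sublocale G: group G using G unfolding is_lie_group_def by blast
sublocale H: group H using H unfolding is_lie_group_def by blast

lemma manifolds: "smooth_manifold (mfd G)" "smooth_manifold (mfd H)"
  and points: "points (mfd G) = carrier G" "points (mfd H) = carrier H"
  using G H unfolding is_lie_group_def by blast+

lemma smooth_mult: "smooth_map (prod_manifold (mfd H) (mfd H)) (mfd H) (\<lambda>(x, y). x \<otimes>\<^bsub>H\<^esub> y)"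
  and smooth_action: "smooth_map (prod_manifold (mfd G) (mfd H)) (mfd H) (\<lambda>(g, h). \<Phi> g h)"
  and smooth_operator: "smooth_map (mfd H) (mfd G) \<B>"
  using H action rota_baxter
  unfolding is_lie_group_def lie_group_action_def relative_rota_baxter_def by blast+

lemma action_auto: "g \<in> carrier G \<Longrightarrow> \<Phi> g \<in> auto H"
  using action unfolding lie_group_action_def lie_Aut_def by (auto dest!: hom_in_carrier)

lemma action_closed: "g \<in> carrier G \<Longrightarrow> h \<in> carrier H \<Longrightarrow> \<Phi> g h \<in> carrier H"
  using action_auto[of g] unfolding auto_def by (auto dest: hom_in_carrier)

lemma action_one: "g \<in> carrier G \<Longrightarrow> \<Phi> g \<one>\<^bsub>H\<^esub> = \<one>\<^bsub>H\<^esub>"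
  using action_auto[of g] unfolding auto_def by (auto intro: hom_one H.is_group)

text \<open>
  The values of \<open>\<Phi>\<close> are bijections, and an idempotent injection is the identity.
\<close>

lemma one_action:
  assumes "h \<in> carrier H"
  shows "\<Phi> \<one>\<^bsub>G\<^esub> h = h"
proof -
  have auto1: "\<Phi> \<one>\<^bsub>G\<^esub> \<in> auto H" using action_auto by simp
  have "\<Phi> \<in> hom G (lie_Aut H)" using action unfolding lie_group_action_def by blast
  then have "\<Phi> (\<one>\<^bsub>G\<^esub> \<otimes>\<^bsub>G\<^esub> \<one>\<^bsub>G\<^esub>) = \<Phi> \<one>\<^bsub>G\<^esub> \<otimes>\<^bsub>lie_Aut H\<^esub> \<Phi> \<one>\<^bsub>G\<^esub>"
    by (rule hom_mult) simp_all
  then have "\<Phi> \<one>\<^bsub>G\<^esub> = compose (carrier H) (\<Phi> \<one>\<^bsub>G\<^esub>) (\<Phi> \<one>\<^bsub>G\<^esub>)"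
    using auto1 by (simp add: lie_Aut_def AutoGroup_def BijGroup_def auto_def)
  then have "\<Phi> \<one>\<^bsub>G\<^esub> (\<Phi> \<one>\<^bsub>G\<^esub> h) = \<Phi> \<one>\<^bsub>G\<^esub> h"
    using assms by (metis compose_eq)
  moreover have "inj_on (\<Phi> \<one>\<^bsub>G\<^esub>) (carrier H)"
    using auto1 unfolding auto_def Bij_def bij_betw_def by blast
  ultimately show ?thesis
    using assms action_closed[of "\<one>\<^bsub>G\<^esub>"] by (meson G.one_closed inj_onD)
qed

lemma operator_closed: "h \<in> carrier H \<Longrightarrow> \<B> h \<in> carrier G"
  using smooth_operator continuous_map_image_subset_topspace points unfolding smooth_map_def by fastforce

text \<open>
  The Rota-Baxter identity at the pair of units makes \<open>\<B> \<one>\<close> idempotent, because \<open>\<Phi> (\<B> \<one>)\<close>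
  fixes the unit.
\<close>

lemma operator_one: "\<B> \<one>\<^bsub>H\<^esub> = \<one>\<^bsub>G\<^esub>"
proof -
  have B1: "\<B> \<one>\<^bsub>H\<^esub> \<in> carrier G" by (simp add: operator_closed)
  have "\<B> \<one>\<^bsub>H\<^esub> \<otimes>\<^bsub>G\<^esub> \<B> \<one>\<^bsub>H\<^esub> = \<B> (\<one>\<^bsub>H\<^esub> \<otimes>\<^bsub>H\<^esub> \<Phi> (\<B> \<one>\<^bsub>H\<^esub>) \<one>\<^bsub>H\<^esub>)"
    using rota_baxter unfolding relative_rota_baxter_def by blast
  then show ?thesis using B1 action_one by (simp add: G.l_cancel_one)
qed

section \<open>Coordinates around the units\<close>

text \<open>
  These are the charts in which \<open>deriv_along\<close> differentiates at the two units; working in them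
  makes every \<open>deriv_along\<close> below a plain Frechet derivative.
\<close>

abbreviation "c\<^sub>0 \<equiv> SOME c. c \<in> charts_at (mfd H) \<one>\<^bsub>H\<^esub>"
abbreviation "a\<^sub>0 \<equiv> SOME a. a \<in> charts_at (mfd G) \<one>\<^bsub>G\<^esub>"
abbreviation "x\<^sub>0 \<equiv> chart_map c\<^sub>0 \<one>\<^bsub>H\<^esub>"
abbreviation "z\<^sub>0 \<equiv> chart_map a\<^sub>0 \<one>\<^bsub>G\<^esub>"

definition mult_coords :: "('b, 'f) chart \<Rightarrow> 'f \<times> 'f \<Rightarrow> 'f" where
  "mult_coords d = (\<lambda>(x, y). chart_map d (chart_inv c\<^sub>0 x \<otimes>\<^bsub>H\<^esub> chart_inv c\<^sub>0 y))"

definition action_coords :: "'e \<times> 'f \<Rightarrow> 'f" where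
  "action_coords = (\<lambda>(z, y). chart_map c\<^sub>0 (\<Phi> (chart_inv a\<^sub>0 z) (chart_inv c\<^sub>0 y)))"

definition operator_coords :: "'f \<Rightarrow> 'e" where
  "operator_coords = chart_map a\<^sub>0 \<circ> \<B> \<circ> chart_inv c\<^sub>0"

text \<open>
  With \<open>q\<close> and \<open>g\<close> the points with coordinates \<open>x\<close> and \<open>z\<close>, the next two functions are the
  differentials at the unit of the left translation by \<open>q\<close> and of the automorphism \<open>\<Phi> g\<close>.
\<close>

definition left_mult_deriv :: "('b, 'f) chart \<Rightarrow> 'f \<Rightarrow> 'f \<Rightarrow> 'f" where
  "left_mult_deriv d x t = frechet_derivative (mult_coords d) (at (x, x\<^sub>0)) (0, t)"

definition action_deriv :: "'e \<Rightarrow> 'f \<Rightarrow> 'f" where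
  "action_deriv z t = frechet_derivative action_coords (at (z, x\<^sub>0)) (0, t)"

lemma base_charts: "c\<^sub>0 \<in> atlas (mfd H)" "\<one>\<^bsub>H\<^esub> \<in> chart_dom c\<^sub>0" "a\<^sub>0 \<in> atlas (mfd G)" "\<one>\<^bsub>G\<^esub> \<in> chart_dom a\<^sub>0"
proof -
  have "\<one>\<^bsub>H\<^esub> \<in> (\<Union>c\<in>atlas (mfd H). chart_dom c)" "\<one>\<^bsub>G\<^esub> \<in> (\<Union>c\<in>atlas (mfd G). chart_dom c)"
    using manifolds points H.one_closed G.one_closed unfolding smooth_manifold_def by metis+
  then have "\<exists>c. c \<in> charts_at (mfd H) \<one>\<^bsub>H\<^esub>" "\<exists>a. a \<in> charts_at (mfd G) \<one>\<^bsub>G\<^esub>"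
    unfolding charts_at_def by blast+
  from someI_ex[OF this(1)] someI_ex[OF this(2)]
  show "c\<^sub>0 \<in> atlas (mfd H)" "\<one>\<^bsub>H\<^esub> \<in> chart_dom c\<^sub>0" "a\<^sub>0 \<in> atlas (mfd G)" "\<one>\<^bsub>G\<^esub> \<in> chart_dom a\<^sub>0"
    unfolding charts_at_def by blast+
qed

lemmas inv_c\<^sub>0 = chart_inv_chart_map[OF manifolds(2) base_charts(1)]
  and inv_a\<^sub>0 = chart_inv_chart_map[OF manifolds(1) base_charts(3)]

lemma chart_inv_base [simp]: "chart_inv c\<^sub>0 x\<^sub>0 = \<one>\<^bsub>H\<^esub>" "chart_inv a\<^sub>0 z\<^sub>0 = \<one>\<^bsub>G\<^esub>"
  by (rule inv_c\<^sub>0[OF base_charts(2)], rule inv_a\<^sub>0[OF base_charts(4)])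

lemma near_one:
  assumes "d \<in> charts_at (mfd H) \<one>\<^bsub>H\<^esub>"
  shows "\<forall>\<^sub>F x in nhds x\<^sub>0. x \<in> chart_map c\<^sub>0 ` chart_dom c\<^sub>0 \<and> chart_inv c\<^sub>0 x \<in> chart_dom d
     \<and> chart_inv c\<^sub>0 x \<in> carrier H"
proof -
  have d: "d \<in> atlas (mfd H)" "\<one>\<^bsub>H\<^esub> \<in> chart_dom d" using assms unfolding charts_at_def by auto
  let ?S = "{x \<in> chart_map c\<^sub>0 ` chart_dom c\<^sub>0. id (chart_inv c\<^sub>0 x) \<in> chart_dom d}"
  have "open ?S"
    using chart_properties(2,4)[OF manifolds(2) base_charts(1)] continuous_map_id
      chart_properties(1)[OF manifolds(2) d(1)] by (rule open_preimage_parametrization)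
  moreover have "x\<^sub>0 \<in> ?S" using d base_charts by simp
  moreover have "chart_dom d \<subseteq> carrier H" using chart_properties(3)[OF manifolds(2) d(1)] points by simp
  ultimately show ?thesis unfolding eventually_nhds by (intro exI[of _ ?S]) auto
qed

lemma c\<^sub>0_charts_at: "c\<^sub>0 \<in> charts_at (mfd H) \<one>\<^bsub>H\<^esub>" and a\<^sub>0_charts_at: "a\<^sub>0 \<in> charts_at (mfd G) \<one>\<^bsub>G\<^esub>"
  using base_charts unfolding charts_at_def by auto

lemma mult_coords_differentiable:
  assumes "d \<in> charts_at (mfd H) \<one>\<^bsub>H\<^esub>" "x \<in> chart_map c\<^sub>0 ` chart_dom c\<^sub>0" "chart_inv c\<^sub>0 x \<in> chart_dom d"
  shows "mult_coords d differentiable (at (x, x\<^sub>0))"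
    and "(\<lambda>p. frechet_derivative (mult_coords d) (at p) w) differentiable (at (x, x\<^sub>0))"
proof -
  have d: "d \<in> atlas (mfd H)" using assms(1) unfolding charts_at_def by auto
  have x: "chart_inv c\<^sub>0 x \<in> carrier H"
    using assms(3) chart_properties(3)[OF manifolds(2) d] points by auto
  note * = smooth_map_in_product_chart[where F = "mult H", OF manifolds(2) manifolds(2) manifolds(2) smooth_mult
      base_charts(1) base_charts(1) d, folded mult_coords_def]
  show "mult_coords d differentiable (at (x, x\<^sub>0))"
    "(\<lambda>p. frechet_derivative (mult_coords d) (at p) w) differentiable (at (x, x\<^sub>0))"
    using assms base_charts x by (auto intro!: *(2,3))
qed

lemma action_coords_differentiable:
  assumes "z \<in> chart_map a\<^sub>0 ` chart_dom a\<^sub>0"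
  shows "action_coords differentiable (at (z, x\<^sub>0))"
    and "(\<lambda>p. frechet_derivative action_coords (at p) w) differentiable (at (z, x\<^sub>0))"
    and "\<forall>\<^sub>F y in nhds x\<^sub>0. \<Phi> (chart_inv a\<^sub>0 z) (chart_inv c\<^sub>0 y) \<in> chart_dom c\<^sub>0"
proof -
  have z: "chart_inv a\<^sub>0 z \<in> carrier G"
    using assms inv_a\<^sub>0 chart_properties(3)[OF manifolds(1) base_charts(3)] points by auto
  let ?S = "{(z, y). z \<in> chart_map a\<^sub>0 ` chart_dom a\<^sub>0 \<and> y \<in> chart_map c\<^sub>0 ` chart_dom c\<^sub>0 \<and>
     \<Phi> (chart_inv a\<^sub>0 z) (chart_inv c\<^sub>0 y) \<in> chart_dom c\<^sub>0}"
  note * = smooth_map_in_product_chart[where F = \<Phi>, OF manifolds(1) manifolds(2) manifolds(2) smooth_action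
      base_charts(3) base_charts(1) base_charts(1), folded action_coords_def]
  have S: "(z, x\<^sub>0) \<in> ?S" using assms base_charts z action_one by simp
  show "action_coords differentiable (at (z, x\<^sub>0))"
    "(\<lambda>p. frechet_derivative action_coords (at p) w) differentiable (at (z, x\<^sub>0))"
    using *(2)[OF S] *(3)[OF S] by auto
  have "open ((\<lambda>y. (z, y)) -` ?S)" using *(1) by (rule open_vimage) (intro continuous_intros)
  then show "\<forall>\<^sub>F y in nhds x\<^sub>0. \<Phi> (chart_inv a\<^sub>0 z) (chart_inv c\<^sub>0 y) \<in> chart_dom c\<^sub>0"
    using S unfolding eventually_nhds by (intro exI[of _ "(\<lambda>y. (z, y)) -` ?S"]) auto
qed

lemma action_coords_base:
  assumes "z \<in> chart_map a\<^sub>0 ` chart_dom a\<^sub>0"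
  shows "action_coords (z, x\<^sub>0) = x\<^sub>0"
proof -
  have "chart_inv a\<^sub>0 z \<in> carrier G"
    using assms inv_a\<^sub>0 chart_properties(3)[OF manifolds(1) base_charts(3)] points by auto
  then show ?thesis by (simp add: action_coords_def action_one)
qed

text \<open>
  The chain rule for \<open>h \<mapsto> q \<cdot> \<Phi> g h\<close>, with \<open>q\<close> and \<open>g\<close> independent of each other.  Taking
  \<open>g = \<B> q\<close>, \<open>g = \<one>\<close> or \<open>q = \<one>\<close> yields respectively the left-invariant fields of the descendent
  group, those of \<open>H\<close>, and the differentiated automorphisms.
\<close>

lemma deriv_mult_action:
  assumes d: "d \<in> charts_at (mfd H) \<one>\<^bsub>H\<^esub>"
    and x: "x \<in> chart_map c\<^sub>0 ` chart_dom c\<^sub>0" "chart_inv c\<^sub>0 x \<in> chart_dom d"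
    and z: "z \<in> chart_map a\<^sub>0 ` chart_dom a\<^sub>0"
  shows "deriv_along (mfd H) \<one>\<^bsub>H\<^esub> v (chart_map d \<circ> (\<lambda>h. chart_inv c\<^sub>0 x \<otimes>\<^bsub>H\<^esub> \<Phi> (chart_inv a\<^sub>0 z) h))
    = left_mult_deriv d x (action_deriv z (v c\<^sub>0))"
proof -
  have id: "((\<lambda>y. y) has_derivative (\<lambda>w. w)) (at x\<^sub>0)" by (rule has_derivative_ident)
  have "((\<lambda>y. action_coords (z, y)) has_derivative action_deriv z) (at x\<^sub>0)"
    using has_derivative_partial_chain[OF action_coords_differentiable(1)[OF z] id]
    unfolding action_deriv_def .
  from has_derivative_partial_chain[OF _ this, of "mult_coords d" x]
  have deriv: "((\<lambda>y. mult_coords d (x, action_coords (z, y))) has_derivative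
      (\<lambda>w. left_mult_deriv d x (action_deriv z w))) (at x\<^sub>0)"
    using mult_coords_differentiable(1)[OF d x]
    by (simp add: action_coords_base[OF z] left_mult_deriv_def)
  have eq: "\<forall>\<^sub>F y in nhds x\<^sub>0. mult_coords d (x, action_coords (z, y)) =
      ((chart_map d \<circ> (\<lambda>h. chart_inv c\<^sub>0 x \<otimes>\<^bsub>H\<^esub> \<Phi> (chart_inv a\<^sub>0 z) h)) \<circ> chart_inv c\<^sub>0) y"
    using action_coords_differentiable(3)[OF z]
    by eventually_elim (simp add: mult_coords_def action_coords_def inv_c\<^sub>0)
  have "(((chart_map d \<circ> (\<lambda>h. chart_inv c\<^sub>0 x \<otimes>\<^bsub>H\<^esub> \<Phi> (chart_inv a\<^sub>0 z) h)) \<circ> chart_inv c\<^sub>0)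
      has_derivative (\<lambda>w. left_mult_deriv d x (action_deriv z w))) (at x\<^sub>0)"
    by (rule iffD1[OF has_derivative_cong_nhds[OF eq] deriv])
  from fun_cong[OF frechet_derivative_at[OF this], symmetric, of "v c\<^sub>0"]
  show ?thesis unfolding deriv_along_def Let_def .
qed

lemma deriv_along_one_cong:
  assumes "\<And>h. h \<in> carrier H \<Longrightarrow> f h = g h"
  shows "deriv_along (mfd H) \<one>\<^bsub>H\<^esub> v f = deriv_along (mfd H) \<one>\<^bsub>H\<^esub> v g"
proof -
  have "\<forall>\<^sub>F y in nhds x\<^sub>0. (f \<circ> chart_inv c\<^sub>0) y = (g \<circ> chart_inv c\<^sub>0) y"
    using near_one[OF c\<^sub>0_charts_at] by eventually_elim (simp add: assms)
  from frechet_derivative_cong[OF this] show ?thesis unfolding deriv_along_def Let_def by (rule fun_cong)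
qed

lemma action_deriv_one: "action_deriv z\<^sub>0 t = t"
proof -
  have id: "((\<lambda>y. y) has_derivative (\<lambda>w. w)) (at x\<^sub>0)" by (rule has_derivative_ident)
  have z: "z\<^sub>0 \<in> chart_map a\<^sub>0 ` chart_dom a\<^sub>0" by (rule imageI[OF base_charts(4)])
  have deriv: "((\<lambda>y. action_coords (z\<^sub>0, y)) has_derivative action_deriv z\<^sub>0) (at x\<^sub>0)"
    using has_derivative_partial_chain[OF action_coords_differentiable(1)[OF z] id]
    unfolding action_deriv_def .
  have eq: "\<forall>\<^sub>F y in nhds x\<^sub>0. action_coords (z\<^sub>0, y) = y"
    using near_one[OF c\<^sub>0_charts_at]
    by eventually_elim (auto simp: action_coords_def one_action inv_c\<^sub>0)
  have "action_deriv z\<^sub>0 = (\<lambda>w. w)"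
    by (rule has_derivative_unique[OF iffD1[OF has_derivative_cong_nhds[OF eq] deriv] id])
  then show ?thesis by simp
qed

lemma deriv_along_one_chart: "deriv_along (mfd H) \<one>\<^bsub>H\<^esub> v (chart_map c\<^sub>0) = v c\<^sub>0"
proof -
  have "\<forall>\<^sub>F y in nhds x\<^sub>0. (chart_map c\<^sub>0 \<circ> chart_inv c\<^sub>0) y = y"
    using near_one[OF c\<^sub>0_charts_at] by eventually_elim (auto simp: inv_c\<^sub>0)
  from frechet_derivative_cong[OF this] show ?thesis
    unfolding deriv_along_def Let_def by (simp only: frechet_derivative_ident)
qed

section \<open>Left-invariant fields of the descendent group\<close>

lemma left_invariant_field_one:
  "left_invariant_field H v \<one>\<^bsub>H\<^esub> c\<^sub>0 = v c\<^sub>0"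
  "left_invariant_field (descendent_lie_group H \<Phi> \<B>) v \<one>\<^bsub>H\<^esub> c\<^sub>0 = v c\<^sub>0"
  using deriv_along_one_cong[of "chart_map c\<^sub>0 \<circ> (\<lambda>h. \<one>\<^bsub>H\<^esub> \<otimes>\<^bsub>H\<^esub> h)" "chart_map c\<^sub>0" v]
    deriv_along_one_cong[of "chart_map c\<^sub>0 \<circ> (\<lambda>h. \<one>\<^bsub>H\<^esub> \<otimes>\<^bsub>H\<^esub> \<Phi> (\<B> \<one>\<^bsub>H\<^esub>) h)" "chart_map c\<^sub>0" v]
    c\<^sub>0_charts_at deriv_along_one_chart one_action
  by (simp_all add: left_invariant_field_def tangent_map_def descendent_lie_group_def operator_one)

lemma left_invariant_field_coords:
  assumes d: "d \<in> charts_at (mfd H) \<one>\<^bsub>H\<^esub>"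
  shows "\<forall>\<^sub>F x in nhds x\<^sub>0. left_invariant_field H v (chart_inv c\<^sub>0 x) d = left_mult_deriv d x (v c\<^sub>0)"
  using near_one[OF d]
proof eventually_elim
  fix x assume x: "x \<in> chart_map c\<^sub>0 ` chart_dom c\<^sub>0 \<and> chart_inv c\<^sub>0 x \<in> chart_dom d \<and> chart_inv c\<^sub>0 x \<in> carrier H"
  have "deriv_along (mfd H) \<one>\<^bsub>H\<^esub> v (chart_map d \<circ> (\<lambda>h. chart_inv c\<^sub>0 x \<otimes>\<^bsub>H\<^esub> h))
     = deriv_along (mfd H) \<one>\<^bsub>H\<^esub> v (chart_map d \<circ> (\<lambda>h. chart_inv c\<^sub>0 x \<otimes>\<^bsub>H\<^esub> \<Phi> (chart_inv a\<^sub>0 z\<^sub>0) h))"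
    by (rule deriv_along_one_cong) (simp add: one_action)
  also have "\<dots> = left_mult_deriv d x (v c\<^sub>0)"
    using deriv_mult_action[OF d, of x z\<^sub>0 v] x base_charts action_deriv_one by simp
  finally show "left_invariant_field H v (chart_inv c\<^sub>0 x) d = left_mult_deriv d x (v c\<^sub>0)"
    using d x by (simp add: left_invariant_field_def tangent_map_def charts_at_def)
qed

lemma descendent_left_invariant_field_coords:
  assumes d: "d \<in> charts_at (mfd H) \<one>\<^bsub>H\<^esub>"
  shows "\<forall>\<^sub>F x in nhds x\<^sub>0. left_invariant_field (descendent_lie_group H \<Phi> \<B>) v (chart_inv c\<^sub>0 x) d
    = left_mult_deriv d x (action_deriv (operator_coords x) (v c\<^sub>0))"
proof -
  have "\<forall>\<^sub>F x in nhds x\<^sub>0. \<B> (chart_inv c\<^sub>0 x) \<in> chart_dom a\<^sub>0"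
    using smooth_map_in_chart(1)[OF manifolds(2,1) smooth_operator base_charts(1,3,2)] base_charts(4)
    by (auto simp: operator_one elim: eventually_mono)
  then show ?thesis using near_one[OF d]
  proof eventually_elim
    fix x assume B: "\<B> (chart_inv c\<^sub>0 x) \<in> chart_dom a\<^sub>0"
      and x: "x \<in> chart_map c\<^sub>0 ` chart_dom c\<^sub>0 \<and> chart_inv c\<^sub>0 x \<in> chart_dom d \<and> chart_inv c\<^sub>0 x \<in> carrier H"
    let ?q = "chart_inv c\<^sub>0 x"
    have "?q \<otimes>\<^bsub>H\<^esub> \<Phi> (\<B> ?q) \<one>\<^bsub>H\<^esub> = ?q" using x operator_closed action_one by simp
    moreover have "chart_inv a\<^sub>0 (operator_coords x) = \<B> ?q"
      "operator_coords x \<in> chart_map a\<^sub>0 ` chart_dom a\<^sub>0"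
      using B by (simp_all add: operator_coords_def inv_a\<^sub>0)
    ultimately show "left_invariant_field (descendent_lie_group H \<Phi> \<B>) v ?q d
        = left_mult_deriv d x (action_deriv (operator_coords x) (v c\<^sub>0))"
      using d x deriv_mult_action[OF d, of x "operator_coords x" v]
      by (simp add: left_invariant_field_def tangent_map_def charts_at_def descendent_lie_group_def)
  qed
qed

lemma action_tilde_coords:
  assumes d: "d \<in> charts_at (mfd H) \<one>\<^bsub>H\<^esub>"
  shows "\<forall>\<^sub>F z in nhds z\<^sub>0. action_tilde H \<Phi> (chart_inv a\<^sub>0 z) v d
    = left_mult_deriv d x\<^sub>0 (action_deriv z (v c\<^sub>0))"
proof -
  have one_d: "\<one>\<^bsub>H\<^esub> \<in> chart_dom d" using d by (simp add: charts_at_def)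
  have "\<forall>\<^sub>F z in nhds z\<^sub>0. z \<in> chart_map a\<^sub>0 ` chart_dom a\<^sub>0"
    using chart_properties(2)[OF manifolds(1) base_charts(3)] base_charts(4)
    unfolding eventually_nhds by blast
  then show ?thesis
  proof eventually_elim
    fix z assume z: "z \<in> chart_map a\<^sub>0 ` chart_dom a\<^sub>0"
    let ?g = "chart_inv a\<^sub>0 z"
    have g: "?g \<in> carrier G"
      using z inv_a\<^sub>0 chart_properties(3)[OF manifolds(1) base_charts(3)] points by auto
    have "deriv_along (mfd H) \<one>\<^bsub>H\<^esub> v (chart_map d \<circ> \<Phi> ?g)
       = deriv_along (mfd H) \<one>\<^bsub>H\<^esub> v (chart_map d \<circ> (\<lambda>h. chart_inv c\<^sub>0 x\<^sub>0 \<otimes>\<^bsub>H\<^esub> \<Phi> ?g h))"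
      by (rule deriv_along_one_cong) (simp add: action_closed[OF g])
    also have "\<dots> = left_mult_deriv d x\<^sub>0 (action_deriv z (v c\<^sub>0))"
      by (rule deriv_mult_action[OF d imageI[OF base_charts(2)] _ z]) (simp add: one_d)
    finally show "action_tilde H \<Phi> ?g v d = left_mult_deriv d x\<^sub>0 (action_deriv z (v c\<^sub>0))"
      using d by (simp add: action_tilde_def tangent_map_def action_one[OF g])
  qed
qed

text \<open>
  The first summand comes from moving the base point of the field with the generating vector held
  at \<open>v\<close>, the second from moving the generating vector at the unit.
\<close>

lemma deriv_descendent_field:
  assumes d: "d \<in> charts_at (mfd H) \<one>\<^bsub>H\<^esub>"
  shows "deriv_along (mfd H) \<one>\<^bsub>H\<^esub> (left_invariant_field (descendent_lie_group H \<Phi> \<B>) w \<one>\<^bsub>H\<^esub>)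
      (\<lambda>q. left_invariant_field (descendent_lie_group H \<Phi> \<B>) v q d)
    = deriv_along (mfd H) \<one>\<^bsub>H\<^esub> (left_invariant_field H w \<one>\<^bsub>H\<^esub>) (\<lambda>q. left_invariant_field H v q d)
      + differentiated_action G H \<Phi> (tangent_map (mfd H) (mfd G) \<B> \<one>\<^bsub>H\<^esub> w) v d"
proof -
  let ?M = "left_mult_deriv d" and ?s = "\<lambda>z. action_deriv z (v c\<^sub>0)" and ?\<beta> = operator_coords
  let ?D\<beta> = "frechet_derivative ?\<beta> (at x\<^sub>0)" and ?Ds = "frechet_derivative ?s (at z\<^sub>0)"
  have one_d: "\<one>\<^bsub>H\<^esub> \<in> chart_dom d" using d by (simp add: charts_at_def)
  have \<beta>0: "?\<beta> x\<^sub>0 = z\<^sub>0" by (simp add: operator_coords_def operator_one)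
  have "?\<beta> differentiable (at x\<^sub>0)"
    using smooth_map_in_chart(2)[OF manifolds(2,1) smooth_operator base_charts(1,3,2)] base_charts(4)
    by (simp add: operator_coords_def operator_one)
  then have \<beta>: "(?\<beta> has_derivative ?D\<beta>) (at x\<^sub>0)" using frechet_derivative_works by blast
  have "(\<lambda>z. frechet_derivative action_coords (at (z, x\<^sub>0)) (0, v c\<^sub>0)) differentiable (at z\<^sub>0)"
    by (rule differentiable_slice[OF action_coords_differentiable(2)[OF imageI[OF base_charts(4)]]])
  then have s: "(?s has_derivative ?Ds) (at z\<^sub>0)"
    unfolding action_deriv_def using frechet_derivative_works by blast
  have \<sigma>: "((\<lambda>x. ?s (?\<beta> x)) has_derivative (\<lambda>u. ?Ds (?D\<beta> u))) (at x\<^sub>0)"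
    using has_derivative_compose[OF \<beta>, of ?s ?Ds] s \<beta>0 by simp
  have bl: "bounded_linear (?M x)"
    if "x \<in> chart_map c\<^sub>0 ` chart_dom c\<^sub>0" "chart_inv c\<^sub>0 x \<in> chart_dom d" for x
  proof -
    have "bounded_linear (frechet_derivative (mult_coords d) (at (x, x\<^sub>0)))"
      using mult_coords_differentiable(1)[OF d that] frechet_derivative_works has_derivative_bounded_linear by blast
    moreover have "bounded_linear (\<lambda>t::'f. (0::'f, t))"
      by (intro bounded_linear_Pair bounded_linear_zero bounded_linear_ident)
    ultimately show ?thesis unfolding left_mult_deriv_def[abs_def] by (rule bounded_linear_compose)
  qed
  have lin: "\<forall>\<^sub>F x in nhds x\<^sub>0. linear (?M x)"
    using near_one[OF d] by eventually_elim (simp add: bl bounded_linear.linear)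
  have diff: "(\<lambda>x. ?M x t) differentiable (at x\<^sub>0)" for t
    unfolding left_mult_deriv_def
    by (rule differentiable_slice[OF mult_coords_differentiable(2)[OF d imageI[OF base_charts(2)]]])
       (simp add: one_d)
  obtain C :: "'f set" where C: "finite C" "span C = UNIV"
    using manifolds(2) unfolding smooth_manifold_def by blast
  (* The vector ?s (?\<beta> x) equals the fixed vector v c\<^sub>0 at x\<^sub>0, since \<Phi> of the unit is the identity. *)
  have "((\<lambda>x. ?M x (?s (?\<beta> x))) has_derivative
      (\<lambda>u. frechet_derivative (\<lambda>x. ?M x (v c\<^sub>0)) (at x\<^sub>0) u + ?M x\<^sub>0 (?Ds (?D\<beta> u)))) (at x\<^sub>0)"
    using has_derivative_linear_family[OF C lin diff \<sigma>] by (simp add: \<beta>0 action_deriv_one)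
  from frechet_derivative_at[OF this]
  have "frechet_derivative ((\<lambda>q. left_invariant_field (descendent_lie_group H \<Phi> \<B>) v q d) \<circ> chart_inv c\<^sub>0) (at x\<^sub>0)
     = (\<lambda>u. frechet_derivative (\<lambda>x. ?M x (v c\<^sub>0)) (at x\<^sub>0) u + ?M x\<^sub>0 (?Ds (?D\<beta> u)))"
    using frechet_derivative_cong[OF descendent_left_invariant_field_coords[OF d, of v]]
    by (simp add: comp_def)
  then have 1: "deriv_along (mfd H) \<one>\<^bsub>H\<^esub> (left_invariant_field (descendent_lie_group H \<Phi> \<B>) w \<one>\<^bsub>H\<^esub>)
      (\<lambda>q. left_invariant_field (descendent_lie_group H \<Phi> \<B>) v q d)
     = frechet_derivative (\<lambda>x. ?M x (v c\<^sub>0)) (at x\<^sub>0) (w c\<^sub>0) + ?M x\<^sub>0 (?Ds (?D\<beta> (w c\<^sub>0)))"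
    by (simp add: deriv_along_def Let_def left_invariant_field_one)
  have 2: "deriv_along (mfd H) \<one>\<^bsub>H\<^esub> (left_invariant_field H w \<one>\<^bsub>H\<^esub>) (\<lambda>q. left_invariant_field H v q d)
     = frechet_derivative (\<lambda>x. ?M x (v c\<^sub>0)) (at x\<^sub>0) (w c\<^sub>0)"
    using frechet_derivative_cong[OF left_invariant_field_coords[OF d, of v]] 
    by (simp add: deriv_along_def Let_def comp_def left_invariant_field_one)
  have "((\<lambda>z. ?M x\<^sub>0 (?s z)) has_derivative (\<lambda>t. ?M x\<^sub>0 (?Ds t))) (at z\<^sub>0)"
    using base_charts one_d by (intro bounded_linear.has_derivative[OF bl] s) auto
  from frechet_derivative_at[OF this]
  have "frechet_derivative ((\<lambda>g. action_tilde H \<Phi> g v d) \<circ> chart_inv a\<^sub>0) (at z\<^sub>0) = (\<lambda>t. ?M x\<^sub>0 (?Ds t))"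
    using frechet_derivative_cong[OF action_tilde_coords[OF d, of v]] by (simp add: comp_def)
  moreover have "tangent_map (mfd H) (mfd G) \<B> \<one>\<^bsub>H\<^esub> w a\<^sub>0 = ?D\<beta> (w c\<^sub>0)"
    using a\<^sub>0_charts_at by (simp add: tangent_map_def operator_one deriv_along_def Let_def operator_coords_def)
  ultimately have "differentiated_action G H \<Phi> (tangent_map (mfd H) (mfd G) \<B> \<one>\<^bsub>H\<^esub> w) v d
      = ?M x\<^sub>0 (?Ds (?D\<beta> (w c\<^sub>0)))"
    using d by (simp add: differentiated_action_def deriv_along_def Let_def)
  with 1 2 show ?thesis by simp
qed

lemma descendent_bracket:
  "vf_bracket (mfd H) (left_invariant_field (descendent_lie_group H \<Phi> \<B>) u)
     (left_invariant_field (descendent_lie_group H \<Phi> \<B>) v) \<one>\<^bsub>H\<^esub> =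
   differentiated_action G H \<Phi> (tangent_map (mfd H) (mfd G) \<B> \<one>\<^bsub>H\<^esub> u) v
     - differentiated_action G H \<Phi> (tangent_map (mfd H) (mfd G) \<B> \<one>\<^bsub>H\<^esub> v) u
     + vf_bracket (mfd H) (left_invariant_field H u) (left_invariant_field H v) \<one>\<^bsub>H\<^esub>"
proof
  fix d
  show "vf_bracket (mfd H) (left_invariant_field (descendent_lie_group H \<Phi> \<B>) u)
     (left_invariant_field (descendent_lie_group H \<Phi> \<B>) v) \<one>\<^bsub>H\<^esub> d =
   (differentiated_action G H \<Phi> (tangent_map (mfd H) (mfd G) \<B> \<one>\<^bsub>H\<^esub> u) v
     - differentiated_action G H \<Phi> (tangent_map (mfd H) (mfd G) \<B> \<one>\<^bsub>H\<^esub> v) u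
     + vf_bracket (mfd H) (left_invariant_field H u) (left_invariant_field H v) \<one>\<^bsub>H\<^esub>) d"
  proof (cases "d \<in> charts_at (mfd H) \<one>\<^bsub>H\<^esub>")
    case True
    then show ?thesis
      using deriv_descendent_field[OF True, of u v] deriv_descendent_field[OF True, of v u]
      by (simp add: vf_bracket_def)
  next
    case False
    then show ?thesis by (simp add: vf_bracket_def differentiated_action_def)
  qed
qed

end

theorem proposition4p5:
  fixes G :: "('a, 'e::real_normed_vector) lie_group"
    and H :: "('b, 'f::real_normed_vector) lie_group"
    and \<Phi> :: "'a \<Rightarrow> 'b \<Rightarrow> 'b"
    and \<B> :: "'b \<Rightarrow> 'a"
  assumes "is_lie_group G"
    and "is_lie_group H"
    and "lie_group_action G H \<Phi>"
    and "relative_rota_baxter G H \<Phi> \<B>"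
  shows "lie_algebra_of (descendent_lie_group H \<Phi> \<B>) =
         descendent_lie_algebra (lie_algebra_of H) (differentiated_action G H \<Phi>)
           (tangent_map (mfd H) (mfd G) \<B> \<one>\<^bsub>H\<^esub>)"
proof -
  interpret rota_baxter_operator G H \<Phi> \<B>
    using assms by unfold_locales
  have "mfd (descendent_lie_group H \<Phi> \<B>) = mfd H" "\<one>\<^bsub>descendent_lie_group H \<Phi> \<B>\<^esub> = \<one>\<^bsub>H\<^esub>"
    by (simp_all add: descendent_lie_group_def)
  then show ?thesis
    by (simp add: lie_algebra_of_def descendent_lie_algebra_def Let_def descendent_bracket cong: restrict_cong)
qed

end
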